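(* Let $H$ be a numerical semigroup minimally generated by $b_1<\dots<b_m$, with conductor valuation $c$, and suppose the numerical semigroup ring $S=\Bbbk[[H]]$ is almost Gorenstein. Then: (1) If $S$ is of maximal reduced type, then $c\leq 2b_1-1$. (2) If $S$ is of minimal reduced type but not Gorenstein, then $c\geq 2b_1+3$.
   Context: $\Bbbk$ is an algebraically closed field of characteristic $0$. A numerical semigroup is a submonoid $H$ of $\mathbb N=\{0,1,2,\dots\}$ with finite complement ($H\neq\mathbb N$, since rings in the paper are non-regular). $S=\Bbbk[[H]]=\Bbbk[[t^{b_1},\dots,t^{b_m}]]\subseteq\overline S=\Bbbk[[t]]$, with maximal ideal $\mathfrak n$. The conductor valuation $c$ is the least integer with $c+i\in H$ for all $i\ge0$; the conductor ideal of $S$ is $\mathfrak C=t^c\overline S$. The reduced type is $s(S)=\dim_\Bbbk\frac{\mathfrak C+t^{b_1}S}{t^{b_1}S}$ and the Cohen–Macaulay type is $\operatorname{type}(S)=\dim_\Bbbk\frac{t^{b_1}S:_S\mathfrak n}{t^{b_1}S}$; one has $1\le s(S)\le\operatorname{type}(S)$. $S$ is of maximal reduced type if $s(S)=\operatorname{type}(S)$ and of minimal reduced type if $s(S)=1$. $S$ is almost Gorenstein if $\ell(\overline S/S)=\ell(S/\mathfrak C)+\operatorname{type}(S)-1$, where $\ell$ denotes length.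
   Formalization: Part (1) is proved under the additional hypothesis that S is not Gorenstein; without it the claim is false, e.g. for H=⟨2,5⟩, where S is Gorenstein with s(S)=type(S)=1, b_1=2, but c=4>3. *)

theory Defs
  imports
    "HOL-Computational_Algebra.Computational_Algebra"
    "HOL-Library.Extended_Nat"
    "HOL-Library.Set_Algebras"
begin

definition is_submonoid :: "nat set \<Rightarrow> bool" where
  "is_submonoid M \<longleftrightarrow> 0 \<in> M \<and> (\<forall>x\<in>M. \<forall>y\<in>M. x + y \<in> M)"

definition numerical_semigroup :: "nat set \<Rightarrow> bool" where
  "numerical_semigroup H \<longleftrightarrow> is_submonoid H \<and> finite (- H) \<and> H \<noteq> UNIV"

definition monoid_generated :: "nat set \<Rightarrow> nat set" where
  "monoid_generated B = \<Inter>{M. is_submonoid M \<and> B \<subseteq> M}"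

definition minimally_generates :: "nat set \<Rightarrow> nat set \<Rightarrow> bool" where
  "minimally_generates B H \<longleftrightarrow>
     monoid_generated B = H \<and> (\<forall>B'. B' \<subset> B \<longrightarrow> monoid_generated B' \<noteq> H)"

definition conductor :: "nat set \<Rightarrow> nat" where
  "conductor H = (LEAST n. \<forall>i. n + i \<in> H)"

text \<open>The ambient ring \<open>k[[t]]\<close> is the type \<open>'a fps\<close>, with \<open>t\<close> being \<open>fps_X\<close>; the ring
  \<open>k[[H]]\<close> consists of the power series all of whose exponents lie in \<open>H\<close>.\<close>

definition semigroup_ring :: "nat set \<Rightarrow> 'a::field fps set" where
  "semigroup_ring H = {f. \<forall>n. fps_nth f n \<noteq> 0 \<longrightarrow> n \<in> H}"

text \<open>The non-units of \<open>S\<close>; this is the maximal ideal when \<open>S\<close> is local.\<close>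

definition max_ideal :: "'a::field fps set \<Rightarrow> 'a fps set" where
  "max_ideal S = {f \<in> S. \<not> (\<exists>g\<in>S. f * g = 1)}"

definition conductor_ideal :: "nat \<Rightarrow> 'a::field fps set" where
  "conductor_ideal c = (fps_X ^ c) *o UNIV"

definition colon_ideal :: "'a::field fps set \<Rightarrow> 'a fps set \<Rightarrow> 'a fps set \<Rightarrow> 'a fps set" where
  "colon_ideal S I J = {f \<in> S. \<forall>g\<in>J. f * g \<in> I}"

text \<open>For \<open>k\<close>-subspaces \<open>N \<subseteq> M\<close> of \<open>k[[t]]\<close>, a finite basis of \<open>M/N\<close> is given by
  a set of representatives. Independence modulo \<open>N\<close> forces distinct
  elements of \<open>B\<close> to have distinct classes, so \<open>card B\<close> is the size of the basis.\<close>

definition quotient_basis :: "'a::field fps set \<Rightarrow> 'a fps set \<Rightarrow> 'a fps set \<Rightarrow> bool" where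
  "quotient_basis N M B \<longleftrightarrow>
     finite B \<and> B \<subseteq> M \<and>
     (\<forall>u. (\<Sum>b\<in>B. fps_const (u b) * b) \<in> N \<longrightarrow> (\<forall>b\<in>B. u b = 0)) \<and>
     (\<forall>f\<in>M. \<exists>u. f - (\<Sum>b\<in>B. fps_const (u b) * b) \<in> N)"

definition quotient_dim :: "'a::field fps set \<Rightarrow> 'a fps set \<Rightarrow> enat" where
  "quotient_dim N M =
     (if \<exists>B. quotient_basis N M B then enat (card (SOME B. quotient_basis N M B)) else \<infinity>)"

definition is_submodule :: "'a::field fps set \<Rightarrow> 'a fps set \<Rightarrow> bool" where
  "is_submodule S M \<longleftrightarrow>
     0 \<in> M \<and> (\<forall>f\<in>M. \<forall>g\<in>M. f + g \<in> M) \<and> (\<forall>r\<in>S. \<forall>f\<in>M. r * f \<in> M)"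

text \<open>The length of the \<open>S\<close>-module \<open>M/N\<close>: the supremum of the lengths of strict chains of
  submodules of \<open>M/N\<close>, which correspond to the \<open>S\<close>-submodules between \<open>N\<close> and \<open>M\<close>.\<close>

definition quotient_length :: "'a::field fps set \<Rightarrow> 'a fps set \<Rightarrow> 'a fps set \<Rightarrow> enat" where
  "quotient_length S N M =
     Sup {enat n | n. \<exists>C. (\<forall>i\<le>n. is_submodule S (C i) \<and> N \<subseteq> C i \<and> C i \<subseteq> M) \<and>
                          (\<forall>i<n. C i \<subset> C (Suc i))}"

text \<open>In the following, \<open>e\<close> is the least minimal generator \<open>b\<^sub>1\<close> of the semigroup.\<close>

definition reduced_type :: "'a::field fps set \<Rightarrow> nat \<Rightarrow> nat \<Rightarrow> enat" where
  "reduced_type S e c =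
     quotient_dim ((fps_X ^ e) *o S) (conductor_ideal c + (fps_X ^ e) *o S)"

definition cm_type :: "'a::field fps set \<Rightarrow> nat \<Rightarrow> enat" where
  "cm_type S e =
     quotient_dim ((fps_X ^ e) *o S) (colon_ideal S ((fps_X ^ e) *o S) (max_ideal S))"

definition maximal_reduced_type :: "'a::field fps set \<Rightarrow> nat \<Rightarrow> nat \<Rightarrow> bool" where
  "maximal_reduced_type S e c \<longleftrightarrow> reduced_type S e c = cm_type S e"

definition minimal_reduced_type :: "'a::field fps set \<Rightarrow> nat \<Rightarrow> nat \<Rightarrow> bool" where
  "minimal_reduced_type S e c \<longleftrightarrow> reduced_type S e c = 1"

text \<open>A Gorenstein ring is a Cohen--Macaulay local ring of type one; one-dimensional domains such
  as \<open>k[[H]]\<close> are Cohen--Macaulay. A Gorenstein \<open>k[[H]]\<close> is of maximal and of minimal reduced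
  type at once, and \<open>c \<le> 2 * b\<^sub>1 - 1\<close> can fail for it: for \<open>k[[t^2, t^5]]\<close> one has
  \<open>c = 4\<close> and \<open>b\<^sub>1 = 2\<close>.\<close>

definition gorenstein :: "'a::field fps set \<Rightarrow> nat \<Rightarrow> bool" where
  "gorenstein S e \<longleftrightarrow> cm_type S e = 1"

text \<open>The \<open>-1\<close> of the defining equation is moved to the other side to avoid
  truncated subtraction.\<close>

definition almost_gorenstein :: "'a::field fps set \<Rightarrow> nat \<Rightarrow> nat \<Rightarrow> bool" where
  "almost_gorenstein S e c \<longleftrightarrow>
     quotient_length S S UNIV + 1 = quotient_length S (conductor_ideal c) S + cm_type S e"

end

theory Submission
  imports Defs
begin

text \<open>All the modules involved are spanned by monomials, so every dimension and length counts a set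
  of exponents. In these terms \<open>type(S)\<close> is the number of pseudo-Frobenius numbers of \<open>H\<close>, and
  \<open>s(S)\<close> is the number of gaps in \<open>[c - b\<^sub>1, c - 1]\<close>, all of which are pseudo-Frobenius. With
  \<open>F = c - 1\<close>, the gaps contain the disjoint sets \<open>{F - h | h \<in> H, h < c}\<close> and \<open>PF - {F}\<close>, and
  almost Gorensteinness says that they exhaust the gaps; hence \<open>p \<mapsto> F - p\<close> preserves \<open>PF - {F}\<close>.
  Apply this to some \<open>p \<in> PF - {F}\<close>. For maximal reduced type both \<open>p\<close> and \<open>F - p\<close> are at
  least \<open>c - b\<^sub>1\<close>, so \<open>c \<le> 2 b\<^sub>1 - 1\<close>. For minimal reduced type both are below \<open>c - b\<^sub>1\<close>,
  so \<open>c \<ge> 2 b\<^sub>1 + 1\<close>, and \<open>c = 2 b\<^sub>1 + 1\<close> or \<open>c = 2 b\<^sub>1 + 2\<close> would force \<open>p = b\<^sub>1\<close>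
  or \<open>F - p = b\<^sub>1\<close>.\<close>

section \<open>Monomial subspaces of the power series ring\<close>

text \<open>From here on \<open>semigroup_ring A\<close> is used for arbitrary sets \<open>A\<close> of exponents, as the
  space of all power series supported on \<open>A\<close>.\<close>

lemma semigroup_ringI: "(\<And>n. n \<notin> A \<Longrightarrow> fps_nth f n = 0) \<Longrightarrow> f \<in> semigroup_ring A"
  by (auto simp: semigroup_ring_def)

lemma semigroup_ring_nth: "f \<in> semigroup_ring A \<Longrightarrow> n \<notin> A \<Longrightarrow> fps_nth f n = 0"
  by (auto simp: semigroup_ring_def)

lemma fps_X_power_in_semigroup_ring [simp]:
  "(fps_X ^ n :: 'a::field fps) \<in> semigroup_ring A \<longleftrightarrow> n \<in> A"
  by (auto simp: semigroup_ring_def fps_X_power_nth split: if_splits)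

lemma semigroup_ring_mono: "A \<subseteq> B \<Longrightarrow> semigroup_ring A \<subseteq> semigroup_ring B"
  by (auto simp: semigroup_ring_def)

lemma semigroup_ring_UNIV [simp]: "semigroup_ring UNIV = UNIV"
  by (simp add: semigroup_ring_def)

lemma semigroup_ring_zero [simp]: "0 \<in> semigroup_ring A"
  by (simp add: semigroup_ring_def)

lemma semigroup_ring_add:
  "f \<in> semigroup_ring A \<Longrightarrow> g \<in> semigroup_ring A \<Longrightarrow> f + g \<in> semigroup_ring A"
  by (auto intro!: semigroup_ringI simp: semigroup_ring_nth)

lemma semigroup_ring_mult:
  assumes "f \<in> semigroup_ring A" "g \<in> semigroup_ring B" "\<And>x y. x \<in> A \<Longrightarrow> y \<in> B \<Longrightarrow> x + y \<in> D"
  shows "f * g \<in> semigroup_ring D"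
proof (rule semigroup_ringI)
  fix n assume n: "n \<notin> D"
  have "fps_nth f i * fps_nth g (n - i) = 0" if "i \<le> n" for i
    using assms n that semigroup_ring_nth[OF assms(1), of i] semigroup_ring_nth[OF assms(2), of "n - i"]
    by (metis le_add_diff_inverse mult_eq_0_iff)
  then show "fps_nth (f * g) n = 0"
    by (auto simp: fps_mult_nth intro!: sum.neutral)
qed

lemma is_submodule_semigroup_ring:
  assumes "\<And>x h. x \<in> A \<Longrightarrow> h \<in> H \<Longrightarrow> x + h \<in> A"
  shows "is_submodule (semigroup_ring H) (semigroup_ring A :: 'a::field fps set)"
  unfolding is_submodule_def
proof (intro conjI ballI)
  fix r f :: "'a fps" assume "r \<in> semigroup_ring H" "f \<in> semigroup_ring A"
  then show "r * f \<in> semigroup_ring A"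
    by (rule semigroup_ring_mult) (metis assms add.commute)
qed (auto intro: semigroup_ring_add)

lemma monomial_elt_set_times:
  "(fps_X ^ e :: 'a::field fps) *o semigroup_ring H = semigroup_ring ((+) e ` H)"
proof
  show "(fps_X ^ e :: 'a fps) *o semigroup_ring H \<subseteq> semigroup_ring ((+) e ` H)"
    unfolding elt_set_times_def
    by (auto intro!: semigroup_ring_mult[where A="{e}"])
  show "semigroup_ring ((+) e ` H) \<subseteq> (fps_X ^ e :: 'a fps) *o semigroup_ring H"
  proof
    fix f :: "'a fps" assume f: "f \<in> semigroup_ring ((+) e ` H)"
    have "f = fps_X ^ e * fps_shift e f"
      using f by (intro fps_ext) (auto simp: fps_X_power_mult_nth semigroup_ring_def not_less)
    moreover have "fps_shift e f \<in> semigroup_ring H"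
      using f by (auto simp: semigroup_ring_def)
    ultimately show "f \<in> fps_X ^ e *o semigroup_ring H"
      unfolding elt_set_times_def by blast
  qed
qed

lemma conductor_ideal_eq_semigroup_ring: "conductor_ideal c = semigroup_ring {c..}"
proof -
  have "(+) c ` UNIV = {c..}"
    by (auto simp: image_iff le_iff_add)
  then show ?thesis
    using monomial_elt_set_times[of c UNIV] by (simp add: conductor_ideal_def)
qed

lemma semigroup_ring_set_plus:
  "(semigroup_ring A + semigroup_ring B :: 'a::field fps set) = semigroup_ring (A \<union> B)"
proof
  show "(semigroup_ring A + semigroup_ring B :: 'a fps set) \<subseteq> semigroup_ring (A \<union> B)"
    using semigroup_ring_mono[of A "A \<union> B"] semigroup_ring_mono[of B "A \<union> B"]
    by (auto simp: set_plus_def intro!: semigroup_ring_add)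
  show "(semigroup_ring (A \<union> B) :: 'a fps set) \<subseteq> semigroup_ring A + semigroup_ring B"
  proof
    fix f :: "'a fps" assume f: "f \<in> semigroup_ring (A \<union> B)"
    define g where "g = Abs_fps (\<lambda>n. if n \<in> A then fps_nth f n else 0)"
    have "g \<in> semigroup_ring A" "f - g \<in> semigroup_ring B"
      using f by (auto simp: g_def semigroup_ring_def)
    moreover have "f = g + (f - g)" by simp
    ultimately show "f \<in> semigroup_ring A + semigroup_ring B"
      unfolding set_plus_def by blast
  qed
qed

text \<open>A series with nonzero constant term is invertible in \<open>k[[t]]\<close>; the point is
  that its inverse again has all exponents in \<open>H\<close>, so it is a unit of
  \<open>k[[H]]\<close> already.\<close>

lemma max_ideal_semigroup_ring:
  assumes "is_submonoid H"
  shows "max_ideal (semigroup_ring H :: 'a::field fps set) = semigroup_ring (H - {0})"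
proof
  show "semigroup_ring (H - {0}) \<subseteq> max_ideal (semigroup_ring H :: 'a fps set)"
  proof
    fix f :: "'a fps" assume f: "f \<in> semigroup_ring (H - {0})"
    then have "fps_nth f 0 = 0" by (simp add: semigroup_ring_nth)
    then have "f * g \<noteq> 1" for g
      by (metis fps_mult_nth_0 fps_one_nth mult_zero_left zero_neq_one)
    with f semigroup_ring_mono[of "H - {0}" H] show "f \<in> max_ideal (semigroup_ring H)"
      by (auto simp: max_ideal_def)
  qed
  show "max_ideal (semigroup_ring H :: 'a fps set) \<subseteq> semigroup_ring (H - {0})"
  proof
    fix f :: "'a fps" assume "f \<in> max_ideal (semigroup_ring H)"
    then have f: "f \<in> semigroup_ring H" and nu: "\<And>g. g \<in> semigroup_ring H \<Longrightarrow> f * g \<noteq> 1"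
      by (auto simp: max_ideal_def)
    have "fps_nth f 0 = 0"
    proof (rule ccontr)
      assume f0: "fps_nth f 0 \<noteq> 0"
      then have inv: "f * inverse f = 1"
        by (simp add: inverse_mult_eq_1')
      \<comment> \<open>Strong induction over the gaps: in the recursion for coefficient
        \<open>n\<close> of the inverse every term with \<open>i > 0\<close> vanishes, because
        \<open>i\<close> and \<open>n - i\<close> cannot both lie in \<open>H\<close> when
        \<open>n\<close> does not.\<close>
      have "n \<notin> H \<Longrightarrow> fps_nth (inverse f) n = 0" for n
      proof (induction n rule: less_induct)
        case (less n)
        have "n \<noteq> 0" using less.prems assms by (metis is_submonoid_def)
        then have "0 = fps_nth (f * inverse f) n" by (simp add: inv)
        also have "\<dots> = fps_nth f 0 * fps_nth (inverse f) n
            + (\<Sum>i\<in>{0<..n}. fps_nth f i * fps_nth (inverse f) (n - i))"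
          by (simp add: fps_mult_nth sum.head)
        also have "(\<Sum>i\<in>{0<..n}. fps_nth f i * fps_nth (inverse f) (n - i)) = 0"
        proof (rule sum.neutral, rule ballI)
          fix i assume i: "i \<in> {0<..n}"
          show "fps_nth f i * fps_nth (inverse f) (n - i) = 0"
          proof (cases "i \<in> H")
            case True
            then have "n - i \<notin> H"
              using less.prems assms i unfolding is_submonoid_def
              by (metis greaterThanAtMost_iff le_add_diff_inverse)
            then show ?thesis using less.IH[of "n - i"] i by simp
          qed (simp add: semigroup_ring_nth[OF f])
        qed
        finally show ?case using f0 by simp
      qed
      then have "inverse f \<in> semigroup_ring H" by (rule semigroup_ringI)
      with nu inv show False by blast
    qed
    with f show "f \<in> semigroup_ring (H - {0})"
      by (auto simp: semigroup_ring_def intro!: gr0I)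
  qed
qed

text \<open>Multiplying by the monomials \<open>fps_X ^ p\<close> only shifts the support, and these
  tests alone already confine it to the exponents on the right.\<close>

lemma colon_ideal_semigroup_ring:
  "colon_ideal (semigroup_ring H :: 'a::field fps set) (semigroup_ring A) (semigroup_ring P)
     = semigroup_ring {h \<in> H. \<forall>p\<in>P. h + p \<in> A}"
proof
  show "colon_ideal (semigroup_ring H :: 'a fps set) (semigroup_ring A) (semigroup_ring P)
     \<subseteq> semigroup_ring {h \<in> H. \<forall>p\<in>P. h + p \<in> A}"
  proof
    fix f :: "'a fps"
    assume "f \<in> colon_ideal (semigroup_ring H) (semigroup_ring A) (semigroup_ring P)"
    then have f: "f \<in> semigroup_ring H"
      and fp: "\<And>p. p \<in> P \<Longrightarrow> f * fps_X ^ p \<in> semigroup_ring A"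
      by (auto simp: colon_ideal_def)
    have "n + p \<in> A" if "fps_nth f n \<noteq> 0" "p \<in> P" for n p
      using semigroup_ring_nth[OF fp[OF that(2)], of "n + p"] that
      by (auto simp: fps_X_power_mult_right_nth)
    with f show "f \<in> semigroup_ring {h \<in> H. \<forall>p\<in>P. h + p \<in> A}"
      by (auto simp: semigroup_ring_def)
  qed
  show "semigroup_ring {h \<in> H. \<forall>p\<in>P. h + p \<in> A}
    \<subseteq> colon_ideal (semigroup_ring H :: 'a fps set) (semigroup_ring A) (semigroup_ring P)"
    using semigroup_ring_mono[of "{h \<in> H. \<forall>p\<in>P. h + p \<in> A}" H]
    by (auto simp: colon_ideal_def intro: semigroup_ring_mult)
qed

section \<open>Dimensions and lengths as cardinalities\<close>

lemma inj_on_fps_X_power: "inj_on (\<lambda>d. fps_X ^ d :: 'a::field fps) D"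
  by (rule inj_onI) (metis fps_X_power_nth zero_neq_one)

lemma quotient_basis_monomials:
  assumes "A \<subseteq> B" "finite (B - A)"
  shows "quotient_basis (semigroup_ring A) (semigroup_ring B :: 'a::field fps set)
           ((\<lambda>d. fps_X ^ d) ` (B - A))"
proof -
  let ?X = "\<lambda>d. fps_X ^ d :: 'a fps"
  note inj = inj_on_fps_X_power[where 'a='a]
  \<comment> \<open>Coefficient \<open>n\<close> of a combination is just the scalar attached to
    \<open>fps_X ^ n\<close>, so independence and spanning can both be read off
    coefficientwise.\<close>
  have nth: "fps_nth (\<Sum>q\<in>?X ` (B - A). fps_const (u q) * q) n
      = (if n \<in> B - A then u (?X n) else 0)" for u n
  proof -
    have "fps_nth (\<Sum>q\<in>?X ` (B - A). fps_const (u q) * q) n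
        = (\<Sum>d\<in>B - A. if d = n then u (?X d) else 0)"
      by (simp add: sum.reindex[OF inj] fps_sum_nth fps_X_power_nth if_distrib cong: if_cong)
        (auto intro!: sum.cong)
    then show ?thesis using assms(2) by simp
  qed
  show ?thesis
    unfolding quotient_basis_def
  proof (intro conjI allI impI ballI)
    show "?X ` (B - A) \<subseteq> semigroup_ring B" by auto
    fix u q
    assume "(\<Sum>q\<in>?X ` (B - A). fps_const (u q) * q) \<in> semigroup_ring A" "q \<in> ?X ` (B - A)"
    then show "u q = 0"
      by (auto simp: nth dest!: semigroup_ring_nth)
  next
    fix f :: "'a fps" assume f: "f \<in> semigroup_ring B"
    \<comment> \<open>The scalars are indexed by basis elements, not by exponents;
      \<open>subdegree\<close> recovers the exponent of a monomial.\<close>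
    have "f - (\<Sum>q\<in>?X ` (B - A). fps_const (fps_nth f (subdegree q)) * q) \<in> semigroup_ring A"
      using f by (intro semigroup_ringI) (auto simp: nth semigroup_ring_nth)
    then show "\<exists>u. f - (\<Sum>q\<in>?X ` (B - A). fps_const (u q) * q) \<in> semigroup_ring A"
      by (rule exI[of _ "\<lambda>q. fps_nth f (subdegree q)"])
  qed (use assms in auto)
qed

text \<open>Truncation to \<open>B - A\<close> carries a basis of the quotient to a basis of
  \<open>semigroup_ring (B - A)\<close> in the usual sense.\<close>

lemma card_quotient_basis_unique:
  fixes Q Q' :: "'a::field fps set"
  assumes "A \<subseteq> B"
    and "quotient_basis (semigroup_ring A) (semigroup_ring B) Q"
    and "quotient_basis (semigroup_ring A) (semigroup_ring B) Q'"
  shows "card Q = card Q'"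
proof -
  \<comment> \<open>With constants acting as scalars, the invariance of the basis size reduces to
    that of \<open>V.dim\<close>.\<close>
  interpret V: vector_space "\<lambda>k (f :: 'a fps). fps_const k * f"
    by unfold_locales (auto simp: algebra_simps fps_const_add[symmetric] fps_const_mult[symmetric]
        simp del: fps_const_add fps_const_mult)
  define D where "D = B - A"
  define \<pi> :: "'a fps \<Rightarrow> 'a fps" where "\<pi> f = Abs_fps (\<lambda>n. if n \<in> D then fps_nth f n else 0)" for f
  have \<pi>_sum: "\<pi> (\<Sum>q\<in>Q. fps_const (u q) * q) = (\<Sum>q\<in>Q. fps_const (u q) * \<pi> q)" for u Q
    by (intro fps_ext) (simp add: \<pi>_def fps_sum_nth)
  have \<pi>_diff: "\<pi> (f - g) = \<pi> f - \<pi> g" for f g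
    by (intro fps_ext) (simp add: \<pi>_def)
  have \<pi>_A: "\<pi> f = 0" if "f \<in> semigroup_ring A" for f
    using that by (intro fps_ext) (auto simp: \<pi>_def D_def semigroup_ring_nth)
  have \<pi>_in_A: "f \<in> semigroup_ring A" if "f \<in> semigroup_ring B" "\<pi> f = 0" for f
  proof (rule semigroup_ringI)
    fix n assume "n \<notin> A"
    then show "fps_nth f n = 0"
      using arg_cong[OF that(2), of "\<lambda>g. fps_nth g n"] semigroup_ring_nth[OF that(1), of n]
      by (auto simp: \<pi>_def D_def split: if_splits)
  qed
  have \<pi>_D: "\<pi> f = f" if "f \<in> semigroup_ring D" for f
    using that by (intro fps_ext) (auto simp: \<pi>_def semigroup_ring_nth)
  have sub: "V.subspace (semigroup_ring E)" for E
    by (rule V.subspaceI) (auto simp: semigroup_ring_add, auto simp: semigroup_ring_def)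
  have "V.dim (semigroup_ring D) = card Q"
    if Q: "quotient_basis (semigroup_ring A) (semigroup_ring B) Q" for Q :: "'a fps set"
  proof -
    have fin: "finite Q" and QB: "Q \<subseteq> semigroup_ring B"
      and ind: "\<And>u q. (\<Sum>b\<in>Q. fps_const (u b) * b) \<in> semigroup_ring A \<Longrightarrow> q \<in> Q \<Longrightarrow> u q = 0"
      and gen: "\<And>f. f \<in> semigroup_ring B \<Longrightarrow>
        \<exists>u. f - (\<Sum>b\<in>Q. fps_const (u b) * b) \<in> semigroup_ring A"
      using Q by (auto simp: quotient_basis_def)
    have sum_B: "(\<Sum>q\<in>Q. fps_const (u q) * q) \<in> semigroup_ring B" for u
      by (rule V.subspace_sum[OF sub]) (use QB V.subspace_scale[OF sub] in blast)
    have ind': "u q = 0" if "(\<Sum>b\<in>Q. fps_const (u b) * \<pi> b) = 0" "q \<in> Q" for u q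
      using ind[OF \<pi>_in_A[OF sum_B]] that by (simp add: \<pi>_sum)
    have inj: "inj_on \<pi> Q"
    proof (rule inj_onI, rule ccontr)
      fix x y assume xy: "x \<in> Q" "y \<in> Q" "\<pi> x = \<pi> y" "x \<noteq> y"
      \<comment> \<open>Difference of the indicators of \<open>x\<close> and \<open>y\<close>: the
        images cancel if \<open>\<pi> x = \<pi> y\<close>, although \<open>u x = 1\<close>.\<close>
      define u where "u q = (if q = x then 1 else 0) - (if q = y then 1 else (0::'a))" for q
      have "(\<Sum>b\<in>Q. fps_const (u b) * \<pi> b)
          = (\<Sum>b\<in>Q. (if b = x then \<pi> b else 0) - (if b = y then \<pi> b else 0))"
        by (intro sum.cong) (auto simp: u_def fps_const_sub[symmetric] simp del: fps_const_sub)
      also have "\<dots> = 0" using xy fin by (simp add: sum_subtractf)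
      finally have "u x = 0" using ind' xy(1) by blast
      with xy(4) show False by (simp add: u_def)
    qed
    have "V.independent (\<pi> ` Q)"
    proof
      assume "V.dependent (\<pi> ` Q)"
      then obtain u q where "q \<in> Q" "u (\<pi> q) \<noteq> 0" "(\<Sum>v\<in>\<pi> ` Q. fps_const (u v) * v) = 0"
        using fin by (auto simp: V.dependent_finite)
      with ind'[of "u \<circ> \<pi>" q] show False by (simp add: sum.reindex[OF inj])
    qed
    moreover have "V.span (\<pi> ` Q) = semigroup_ring D"
    proof
      show "V.span (\<pi> ` Q) \<subseteq> semigroup_ring D"
        by (rule V.span_minimal[OF _ sub]) (auto simp: \<pi>_def semigroup_ring_def split: if_splits)
      show "semigroup_ring D \<subseteq> V.span (\<pi> ` Q)"
      proof
        fix f :: "'a fps" assume f: "f \<in> semigroup_ring D"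
        have "f \<in> semigroup_ring B" using f by (auto simp: semigroup_ring_def D_def)
        then obtain u where u: "f - (\<Sum>b\<in>Q. fps_const (u b) * b) \<in> semigroup_ring A"
          using gen by blast
        have "f = (\<Sum>b\<in>Q. fps_const (u b) * \<pi> b)"
          using \<pi>_A[OF u] \<pi>_D[OF f] by (simp add: \<pi>_diff \<pi>_sum)
        also have "\<dots> \<in> V.span (\<pi> ` Q)"
          by (intro V.span_sum V.span_scale V.span_base) auto
        finally show "f \<in> V.span (\<pi> ` Q)" .
      qed
    qed
    then have "V.span (\<pi> ` Q) = V.span (semigroup_ring D)"
      by (metis V.span_span)
    ultimately have "V.dim (semigroup_ring D) = card (\<pi> ` Q)"
      by (intro V.dim_eq_card) auto
    then show ?thesis by (simp add: card_image[OF inj])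
  qed
  with assms(2,3) show ?thesis by metis
qed

text \<open>All bases have the same size, so the one picked by \<open>SOME\<close> may be replaced
  by the monomial basis.\<close>

lemma quotient_dim_semigroup_ring:
  assumes "A \<subseteq> B" "finite (B - A)"
  shows "quotient_dim (semigroup_ring A) (semigroup_ring B :: 'a::field fps set) = enat (card (B - A))"
proof -
  note basis = quotient_basis_monomials[where 'a='a, OF assms]
  let ?Q = "SOME Q. quotient_basis (semigroup_ring A) (semigroup_ring B :: 'a fps set) Q"
  have "card ?Q = card ((\<lambda>d. fps_X ^ d :: 'a fps) ` (B - A))"
    by (rule card_quotient_basis_unique[OF assms(1) someI[of _ "(\<lambda>d. fps_X ^ d) ` (B - A)"]])
      (rule basis)+
  also have "\<dots> = card (B - A)"
    by (rule card_image[OF inj_on_fps_X_power])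
  finally show ?thesis
    using basis unfolding quotient_dim_def by auto
qed

section \<open>Value sets of submodules and the computation of lengths\<close>

text \<open>The value set under the \<open>t\<close>-adic valuation. Zero is removed because the
  convention \<open>subdegree 0 = 0\<close> would add a spurious value.\<close>

definition orders :: "'a::field fps set \<Rightarrow> nat set" where
  "orders C = subdegree ` (C - {0})"

lemma orders_mono: "C \<subseteq> C' \<Longrightarrow> orders C \<subseteq> orders C'"
  by (auto simp: orders_def)

lemma orders_semigroup_ring: "orders (semigroup_ring A :: 'a::field fps set) = A"
proof
  show "orders (semigroup_ring A :: 'a fps set) \<subseteq> A"
    unfolding orders_def semigroup_ring_def using nth_subdegree_nonzero by blast
  show "A \<subseteq> orders (semigroup_ring A :: 'a fps set)"
  proof
    fix n assume "n \<in> A"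
    then have "(fps_X ^ n :: 'a fps) \<in> semigroup_ring A - {0}" by simp
    then have "subdegree (fps_X ^ n :: 'a fps) \<in> subdegree ` (semigroup_ring A - {0} :: 'a fps set)"
      by (rule imageI)
    then show "n \<in> orders (semigroup_ring A :: 'a fps set)"
      by (simp add: orders_def)
  qed
qed

text \<open>Elements of \<open>C\<close> cancel the leading term of an element of \<open>C'\<close>
  again and again, until the remainder has order at least \<open>N\<close> and so lies in
  \<open>C\<close>.\<close>

lemma submodule_eq_if_orders_eq:
  fixes C C' :: "'a::field fps set"
  assumes "0 \<in> H" "is_submodule (semigroup_ring H) C" "is_submodule (semigroup_ring H) C'"
    and "C \<subseteq> C'" "orders C' \<subseteq> orders C" "semigroup_ring {N..} \<subseteq> C"
  shows "C = C'"
proof -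
  have const: "fps_const k \<in> semigroup_ring H" for k :: 'a
    using assms(1) by (auto simp: semigroup_ring_def)
  have combination: "f + fps_const k * g \<in> M"
    if "is_submodule (semigroup_ring H) M" "f \<in> M" "g \<in> M" for f g :: "'a fps" and k M
    using that const unfolding is_submodule_def by blast
  have "f \<in> C" if "f \<in> C'" for f
    using that
  \<comment> \<open>The measure drops because each cancellation raises the order; it reaches 0
    exactly when the order is at least \<open>N\<close>.\<close>
  proof (induction "N - subdegree f" arbitrary: f rule: less_induct)
    case less
    show ?case
    proof (cases "f = 0 \<or> subdegree f \<ge> N")
      case True
      then have "f \<in> semigroup_ring {N..}"
        by (auto intro!: semigroup_ringI intro: nth_less_subdegree_zero)
      then show ?thesis using assms(6) by blast
    next
      case False
      then have "subdegree f \<in> orders C'" using less.prems by (auto simp: orders_def)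
      then have "subdegree f \<in> orders C" using assms(5) by blast
      then obtain g where "subdegree f = subdegree g" "g \<in> C - {0}"
        unfolding orders_def by (rule imageE)
      then have g: "g \<in> C" "g \<noteq> 0" "subdegree g = subdegree f" by auto
      \<comment> \<open>Ratio of the leading coefficients, chosen so that \<open>r\<close> loses the
        leading term of \<open>f\<close>.\<close>
      define k where "k = fps_nth f (subdegree f) / fps_nth g (subdegree f)"
      define r where "r = f + fps_const (- k) * g"
      have g0: "fps_nth g (subdegree f) \<noteq> 0"
        using g(2) nth_subdegree_nonzero[of g] unfolding g(3) by blast
      have r0: "fps_nth r n = 0" if "n \<le> subdegree f" for n
      proof (cases "n = subdegree f")
        case True
        with g0 show ?thesis by (simp add: r_def k_def)
      next
        case False
        with that g(3) have "n < subdegree f" "n < subdegree g" by linarith+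
        then have "fps_nth f n = 0" "fps_nth g n = 0"
          by (blast intro: nth_less_subdegree_zero)+
        then show ?thesis by (simp add: r_def)
      qed
      have "r \<in> C'"
        unfolding r_def by (rule combination[OF assms(3) less.prems subsetD[OF assms(4) g(1)]])
      have "r \<in> C"
      proof (cases "r = 0")
        case True
        then show ?thesis using assms(2) by (simp add: is_submodule_def)
      next
        case nz: False
        then have "subdegree f < subdegree r"
          using r0 by (metis not_le nth_subdegree_nonzero)
        then have "N - subdegree r < N - subdegree f" using False by linarith
        then show ?thesis using \<open>r \<in> C'\<close> by (rule less.hyps)
      qed
      moreover have "fps_const (- k) * g = - (fps_const k * g)"
        by (metis fps_const_neg mult_minus_left)
      then have "f = r + fps_const k * g" by (simp add: r_def)
      ultimately show ?thesis using combination[OF assms(2) _ g(1)] by metis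
    qed
  qed
  with assms(4) show ?thesis by blast
qed

text \<open>Removing the least element of \<open>B - A\<close> from \<open>B\<close> keeps \<open>B\<close> stable under translation.\<close>

lemma monomial_chain_exists:
  assumes "finite (B - A)" "A \<subseteq> B"
    and "\<And>x h. x \<in> A \<Longrightarrow> h \<in> H \<Longrightarrow> x + h \<in> A" "\<And>x h. x \<in> B \<Longrightarrow> h \<in> H \<Longrightarrow> x + h \<in> B"
  shows "\<exists>T. (\<forall>i\<le>card (B - A). (\<forall>x\<in>T i. \<forall>h\<in>H. x + h \<in> T i) \<and> A \<subseteq> T i \<and> T i \<subseteq> B)
             \<and> (\<forall>i<card (B - A). T i \<subset> (T (Suc i) :: nat set))"
  using assms
proof (induction "card (B - A)" arbitrary: B)
  case 0
  then show ?case by (intro exI[of _ "\<lambda>_. A"]) auto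
next
  case (Suc n)
  define d where "d = Min (B - A)"
  have ne: "B - A \<noteq> {}" using Suc.hyps(2) by (metis card.empty nat.distinct(1))
  then have d: "d \<in> B - A" using Suc.prems(1) Min_in unfolding d_def by blast
  have dmin: "d \<le> x" if "x \<in> B - A" for x using that Suc.prems(1) by (simp add: d_def)
  let ?B = "B - {d}"
  have "?B - A = (B - A) - {d}" by auto
  then have card: "card (?B - A) = n" and fin: "finite (?B - A)"
    using d Suc.hyps(2) Suc.prems(1) by (simp_all add: card_Diff_singleton)
  have stable: "x + h \<in> ?B" if "x \<in> ?B" "h \<in> H" for x h
  proof -
    have "x + h \<noteq> d"
    proof
      assume eq: "x + h = d"
      \<comment> \<open>Here \<open>x\<close> differs from \<open>d\<close>, so \<open>h\<close> is
        positive; minimality of \<open>d\<close> then puts \<open>x\<close> into \<open>A\<close>,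
        and stability of \<open>A\<close> would put \<open>d\<close> there too.\<close>
      then have "x < d" using that(1) by (cases "h = 0") auto
      then have "x \<in> A" using dmin[of x] that(1) by auto
      then have "d \<in> A" using Suc.prems(3)[of x h] that(2) eq by simp
      then show False using d by simp
    qed
    then show ?thesis using Suc.prems(4) that by auto
  qed
  have "A \<subseteq> ?B" using d Suc.prems(2) by auto
  from Suc.hyps(1)[of ?B, unfolded card, OF refl fin this Suc.prems(3) stable]
  obtain T where T: "\<And>i. i \<le> n \<Longrightarrow> (\<forall>x\<in>T i. \<forall>h\<in>H. x + h \<in> T i) \<and> A \<subseteq> T i \<and> T i \<subseteq> ?B"
    "\<And>i. i < n \<Longrightarrow> T i \<subset> T (Suc i)"
    by blast
  \<comment> \<open>The chain for \<open>?B\<close> is extended by \<open>B\<close> as its new top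
    member.\<close>
  define T' where "T' i = (if i \<le> n then T i else B)" for i
  have "T' i \<subset> T' (Suc i)" if "i < Suc n" for i
    using that T(1)[of n] T(2)[of i] d by (cases "i = n") (auto simp: T'_def)
  moreover have "(\<forall>x\<in>T' i. \<forall>h\<in>H. x + h \<in> T' i) \<and> A \<subseteq> T' i \<and> T' i \<subseteq> B" for i
  proof (cases "i \<le> n")
    case True
    with T(1)[OF True] show ?thesis by (auto simp: T'_def)
  next
    case False
    with Suc.prems show ?thesis by (auto simp: T'_def)
  qed
  ultimately show ?case
    unfolding Suc.hyps(2)[symmetric] by (intro exI[of _ T']) blast
qed

text \<open>A chain of monomial submodules attains the bound. No chain is longer, since each strict
  inclusion of submodules containing \<open>semigroup_ring {N..}\<close> adds a new order in
  \<open>B - A\<close>.\<close>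

lemma quotient_length_semigroup_ring:
  assumes "0 \<in> H" "A \<subseteq> B" "{N..} \<subseteq> A"
    and "\<And>x h. x \<in> A \<Longrightarrow> h \<in> H \<Longrightarrow> x + h \<in> A" "\<And>x h. x \<in> B \<Longrightarrow> h \<in> H \<Longrightarrow> x + h \<in> B"
  shows "quotient_length (semigroup_ring H) (semigroup_ring A) (semigroup_ring B :: 'a::field fps set)
           = enat (card (B - A))"
proof -
  let ?S = "semigroup_ring :: nat set \<Rightarrow> 'a fps set"
  have "B - A \<subseteq> {..<N}" using assms(3) by (metis Diff_iff atLeast_iff lessThan_iff not_le subset_iff)
  then have fin: "finite (B - A)" using finite_subset by blast
  have lower: "\<exists>C. (\<forall>i\<le>card (B - A). is_submodule (?S H) (C i) \<and> ?S A \<subseteq> C i \<and> C i \<subseteq> ?S B)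
      \<and> (\<forall>i<card (B - A). C i \<subset> C (Suc i))"
  proof -
    obtain T where T: "\<And>i. i \<le> card (B - A) \<Longrightarrow>
        (\<forall>x\<in>T i. \<forall>h\<in>H. x + h \<in> T i) \<and> A \<subseteq> T i \<and> T i \<subseteq> B"
      and str: "\<And>i. i < card (B - A) \<Longrightarrow> T i \<subset> T (Suc i)"
      using monomial_chain_exists[of B A H] fin assms by blast
    have "?S (T i) \<subset> ?S (T (Suc i))" if "i < card (B - A)" for i
      using str[OF that] semigroup_ring_mono[of "T i" "T (Suc i)"]
        orders_semigroup_ring[where 'a='a, of "T i"]
        orders_semigroup_ring[where 'a='a, of "T (Suc i)"] by (metis psubset_eq)
    moreover have "is_submodule (?S H) (?S (T i)) \<and> ?S A \<subseteq> ?S (T i) \<and> ?S (T i) \<subseteq> ?S B"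
      if "i \<le> card (B - A)" for i
      using T[OF that] by (auto intro: is_submodule_semigroup_ring semigroup_ring_mono[THEN subsetD])
    ultimately show ?thesis by (intro exI[of _ "\<lambda>i. ?S (T i)"]) blast
  qed
  have upper: "n \<le> card (B - A)"
    if C: "\<And>i. i \<le> n \<Longrightarrow> is_submodule (?S H) (C i) \<and> ?S A \<subseteq> C i \<and> C i \<subseteq> ?S B"
      and str: "\<And>i. i < n \<Longrightarrow> C i \<subset> C (Suc i)" for n C
  proof -
    have ord: "A \<subseteq> orders (C i)" "orders (C i) \<subseteq> B" if "i \<le> n" for i
      using C[OF that] orders_mono orders_semigroup_ring by metis+
    \<comment> \<open>Orders are counted outside \<open>A\<close>: the full sets
      \<open>orders (C i)\<close> contain \<open>{N..}\<close> and are infinite.\<close>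
    have "i \<le> n \<Longrightarrow> i \<le> card (orders (C i) - A)" for i
    proof (induction i)
      case (Suc i)
      have "?S {N..} \<subseteq> C i"
        using C[of i] semigroup_ring_mono[OF assms(3), where 'a='a] Suc.prems by force
      then have "\<not> orders (C (Suc i)) \<subseteq> orders (C i)"
        using submodule_eq_if_orders_eq[OF assms(1), of "C i" "C (Suc i)" N]
          C[of i] C[of "Suc i"] str[of i] Suc.prems by auto
      moreover have "orders (C i) \<subseteq> orders (C (Suc i))"
        using str[of i] Suc.prems by (intro orders_mono) auto
      ultimately have "orders (C i) - A \<subset> orders (C (Suc i)) - A"
        using ord(1)[of i] Suc.prems by auto
      moreover have "finite (orders (C (Suc i)) - A)"
        using ord(2)[OF Suc.prems] fin by (meson Diff_mono finite_subset order_refl)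
      ultimately have "card (orders (C i) - A) < card (orders (C (Suc i)) - A)"
        by (rule psubset_card_mono[rotated])
      then show ?case using Suc by simp
    qed simp
    then have "n \<le> card (orders (C n) - A)" by simp
    also have "\<dots> \<le> card (B - A)"
      using ord(2)[of n] fin by (intro card_mono) auto
    finally show ?thesis .
  qed
  show ?thesis
    unfolding quotient_length_def
  proof (rule antisym)
    show "enat (card (B - A)) \<le> Sup {enat n | n. \<exists>C. (\<forall>i\<le>n. is_submodule (?S H) (C i)
        \<and> ?S A \<subseteq> C i \<and> C i \<subseteq> ?S B) \<and> (\<forall>i<n. C i \<subset> C (Suc i))}"
      using lower by (intro Sup_upper) blast
  next
    show "Sup {enat n | n. \<exists>C. (\<forall>i\<le>n. is_submodule (?S H) (C i)
        \<and> ?S A \<subseteq> C i \<and> C i \<subseteq> ?S B) \<and> (\<forall>i<n. C i \<subset> C (Suc i))} \<le> enat (card (B - A))"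
    proof (rule Sup_least, elim CollectE exE conjE)
      fix x n C
      assume "x = enat n" and C: "\<forall>i\<le>n. is_submodule (?S H) (C i) \<and> ?S A \<subseteq> C i \<and> C i \<subseteq> ?S B"
        "\<forall>i<n. C i \<subset> C (Suc i)"
      have "n \<le> card (B - A)"
        by (rule upper[of n C]) (rule C[rule_format], assumption)+
      with \<open>x = enat n\<close> show "x \<le> enat (card (B - A))" by simp
    qed
  qed
qed

section \<open>Pseudo-Frobenius numbers\<close>

definition pseudo_frobenius :: "nat set \<Rightarrow> nat set" where
  "pseudo_frobenius H = {p. p \<notin> H \<and> (\<forall>h\<in>H - {0}. p + h \<in> H)}"

text \<open>The hypothesis \<open>card\<close> forces the disjoint sets \<open>?R\<close> and
  \<open>?P - {F}\<close> to fill the gaps. The \<open>+ 1\<close> arises because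
  \<open>F = F - 0\<close> belongs to \<open>?R\<close> and is therefore taken out of
  \<open>?P\<close>.\<close>

lemma pseudo_frobenius_symmetric:
  assumes "is_submonoid H" "F \<notin> H" "{Suc F..} \<subseteq> H"
    and card: "card (- H) + 1 = card (H - {Suc F..}) + card (pseudo_frobenius H)"
    and p: "p \<in> pseudo_frobenius H" "p \<noteq> F"
  shows "p \<le> F \<and> F - p \<in> pseudo_frobenius H"
proof -
  let ?R = "(\<lambda>h. F - h) ` (H - {Suc F..})" and ?P = "pseudo_frobenius H"
  have small: "x \<le> F" if "x \<notin> H" for x
    using assms(3) that by (meson atLeast_iff not_less_eq_eq subsetD)
  have "- H \<subseteq> {..F}" using small by auto
  then have fin: "finite (- H)" by (rule finite_subset) simp
  have P: "?P \<subseteq> - H" by (auto simp: pseudo_frobenius_def)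
  have "F + h \<in> H" if "h \<in> H - {0}" for h
    using that by (intro subsetD[OF assms(3)]) auto
  then have F: "F \<in> ?P" using assms(2) by (auto simp: pseudo_frobenius_def)
  \<comment> \<open>Otherwise \<open>F - x\<close> is a nonzero element of \<open>H\<close>, and
    adding it to the pseudo-Frobenius number \<open>x\<close> gives \<open>F\<close> in
    \<open>H\<close>.\<close>
  have gap: "F - x \<notin> H" if x: "x \<in> ?P - {F}" for x
  proof
    assume "F - x \<in> H"
    moreover have le: "x \<le> F" using x P small by auto
    moreover have "F - x \<noteq> 0" using x le by auto
    moreover have "\<forall>h\<in>H - {0}. x + h \<in> H" using x by (simp add: pseudo_frobenius_def)
    ultimately have "x + (F - x) \<in> H" by (metis DiffI singletonD)
    with le assms(2) show False by simp
  qed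
  have "F - h \<notin> H" if "h \<in> H - {Suc F..}" for h
  proof
    assume "F - h \<in> H"
    with that have "h + (F - h) \<in> H" using assms(1) unfolding is_submonoid_def by blast
    with that assms(2) show False by simp
  qed
  then have sub: "?R \<union> (?P - {F}) \<subseteq> - H" using P by auto
  \<comment> \<open>By \<open>gap\<close>, a common element \<open>F - h\<close> would make
    \<open>F - (F - h) = h\<close> a gap.\<close>
  have "F - h \<notin> ?P - {F}" if "h \<in> H - {Suc F..}" for h
    using gap[of "F - h"] that by auto
  then have disj: "?R \<inter> (?P - {F}) = {}" by blast
  have "card ?R = card (H - {Suc F..})"
    by (rule card_image) (auto intro!: inj_onI)
  moreover have finP: "finite ?P" using P fin by (rule finite_subset)
  moreover have "finite ?R" by (rule finite_subset[OF _ fin]) (use sub in auto)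
  moreover have "Suc (card (?P - {F})) = card ?P"
    using F by (intro card_Suc_Diff1 finP)
  ultimately have "card (?R \<union> (?P - {F})) + 1 = card (H - {Suc F..}) + card ?P"
    using disj by (subst card_Un_disjoint) simp_all
  with card have "card (?R \<union> (?P - {F})) = card (- H)" by linarith
  with fin sub have eq: "?R \<union> (?P - {F}) = - H" by (intro card_subset_eq)
  have "p \<le> F" using p P small by auto
  \<comment> \<open>The gap \<open>F - p\<close> must lie in one of the two sets. It is not in
    \<open>?R\<close>: from \<open>F - p = F - h\<close> with \<open>p\<close> and \<open>h\<close>
    at most \<open>F\<close>, truncated subtraction still yields \<open>p = h\<close>.\<close>
  have "F - p \<in> ?R \<union> (?P - {F})" using gap p eq by auto
  moreover have "F - p \<notin> ?R"
  proof
    assume "F - p \<in> ?R"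
    then obtain h where "h \<in> H - {Suc F..}" "F - p = F - h" by blast
    then have "h \<in> H" "h \<le> F" "F - p = F - h" by auto
    with \<open>p \<le> F\<close> have "p \<in> H" by (metis diff_diff_cancel)
    with p P show False by auto
  qed
  ultimately show ?thesis using \<open>p \<le> F\<close> by auto
qed

section \<open>Multiplicity and conductor of the semigroup\<close>

lemma monoid_generated_superset: "B \<subseteq> monoid_generated B"
  by (auto simp: monoid_generated_def)

lemma monoid_generated_least: "is_submonoid M \<Longrightarrow> B \<subseteq> M \<Longrightarrow> monoid_generated B \<subseteq> M"
  by (auto simp: monoid_generated_def)

text \<open>Minimality rules out the generator 0, and \<open>H \<noteq> UNIV\<close> rules out 1.
  The lower bound holds because \<open>insert 0 {b 1..}\<close> is a submonoid containing all
  generators.\<close>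

lemma least_minimal_generator:
  fixes b :: "nat \<Rightarrow> nat" and m :: nat
  assumes "numerical_semigroup H" "strict_mono_on {1..m} b"
    and min: "minimally_generates (b ` {1..m}) H"
  shows "b 1 \<in> H" "1 < b 1" "\<And>h. h \<in> H \<Longrightarrow> h \<noteq> 0 \<Longrightarrow> b 1 \<le> h"
proof -
  let ?B = "b ` {1..m}"
  have gen: "monoid_generated ?B = H" using min by (simp add: minimally_generates_def)
  have H: "0 \<in> H" "finite (- H)" "H \<noteq> UNIV" "\<And>x y. x \<in> H \<Longrightarrow> y \<in> H \<Longrightarrow> x + y \<in> H"
    using assms(1) by (auto simp: numerical_semigroup_def is_submonoid_def)
  \<comment> \<open>Without generators the monoid would be \<open>{0}\<close>, whose complement is
    infinite; so \<open>b 1\<close> really is a generator.\<close>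
  have "m \<noteq> 0"
  proof
    assume "m = 0"
    then have "H \<subseteq> {0}"
      using gen monoid_generated_least[of "{0}" ?B] by (simp add: is_submonoid_def)
    then have "- {0} \<subseteq> - H" by auto
    then have "finite (- {0::nat})" using H(2) finite_subset by blast
    then show False by simp
  qed
  then have b1: "b 1 \<in> ?B" by auto
  then show "b 1 \<in> H" using gen monoid_generated_superset by blast
  have "b 1 \<noteq> 0"
  proof
    assume "b 1 = 0"
    \<comment> \<open>Every submonoid contains 0, so dropping the generator 0 leaves the generated
      monoid unchanged.\<close>
    then have "is_submonoid M \<and> ?B - {b 1} \<subseteq> M \<longleftrightarrow> is_submonoid M \<and> ?B \<subseteq> M" for M
      by (auto simp: is_submonoid_def)
    then have "monoid_generated (?B - {b 1}) = H"
      unfolding gen[symmetric] monoid_generated_def by simp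
    moreover have "?B - {b 1} \<subset> ?B" using b1 by blast
    ultimately show False using min unfolding minimally_generates_def by blast
  qed
  moreover have "b 1 \<noteq> 1"
  proof
    assume "b 1 = 1"
    then have "1 \<in> H" using \<open>b 1 \<in> H\<close> by simp
    have "n \<in> H" for n
      by (induction n) (use H(1) H(4)[OF _ \<open>1 \<in> H\<close>] in auto)
    then show False using H(3) by blast
  qed
  ultimately show "1 < b 1" by simp
  have "b 1 \<le> x" if "x \<in> ?B" for x
    using that strict_mono_on_leD[OF assms(2)] by auto
  then have "?B \<subseteq> insert 0 {b 1..}" by auto
  moreover have "is_submonoid (insert 0 {b 1..})" by (auto simp: is_submonoid_def)
  ultimately have "H \<subseteq> insert 0 {b 1..}" using gen monoid_generated_least by blast
  then show "\<And>h. h \<in> H \<Longrightarrow> h \<noteq> 0 \<Longrightarrow> b 1 \<le> h" by auto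
qed

text \<open>Positivity makes \<open>conductor H - 1\<close> an honest predecessor, namely the
  Frobenius number.\<close>

lemma conductor_properties:
  assumes "numerical_semigroup H"
  shows "0 < conductor H" "{conductor H..} \<subseteq> H" "conductor H - 1 \<notin> H"
proof -
  have H: "0 \<in> H" "finite (- H)" "H \<noteq> UNIV"
    using assms by (auto simp: numerical_semigroup_def is_submonoid_def)
  obtain N where "- H \<subseteq> {..<N}" using H(2) finite_nat_iff_bounded by blast
  then have "\<forall>i. N + i \<in> H" by (metis ComplI lessThan_iff not_add_less1 subsetD)
  then have all: "\<forall>i. conductor H + i \<in> H" unfolding conductor_def by (rule LeastI)
  show "{conductor H..} \<subseteq> H"
  proof
    fix x assume "x \<in> {conductor H..}"
    then show "x \<in> H" using all[rule_format, of "x - conductor H"] by simp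
  qed
  show pos: "0 < conductor H"
  proof (rule gr0I)
    assume "conductor H = 0"
    with all H(3) show False by auto
  qed
  show "conductor H - 1 \<notin> H"
  proof
    assume a: "conductor H - 1 \<in> H"
    have "conductor H - 1 + i \<in> H" for i
    proof (cases i)
      case (Suc j)
      then show ?thesis using all[rule_format, of j] pos by simp
    qed (use a in simp)
    then have "conductor H \<le> conductor H - 1"
      unfolding conductor_def by (intro Least_le) blast
    with pos show False by simp
  qed
qed

section \<open>Type, reduced type and almost Gorensteinness in terms of exponents\<close>

locale numerical_semigroup_with_multiplicity =
  fixes H :: "nat set" and e c :: nat
  assumes submonoid: "is_submonoid H"
    and e: "e \<in> H" "1 < e" "\<And>h. h \<in> H \<Longrightarrow> h \<noteq> 0 \<Longrightarrow> e \<le> h"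
    and c: "0 < c" "{c..} \<subseteq> H" "c - 1 \<notin> H"
begin

lemma zero: "0 \<in> H" and add: "x \<in> H \<Longrightarrow> y \<in> H \<Longrightarrow> x + y \<in> H"
  using submonoid by (auto simp: is_submonoid_def)

lemma finite_gaps: "finite (- H)"
proof -
  have "- H \<subseteq> {..<c}" using c(2) by (auto simp: not_le[symmetric])
  then show ?thesis using finite_subset by blast
qed

lemma finite_pseudo_frobenius: "finite (pseudo_frobenius H)"
  by (rule finite_subset[OF _ finite_gaps]) (auto simp: pseudo_frobenius_def)

lemma frobenius_in_pseudo_frobenius: "c - 1 \<in> pseudo_frobenius H"
  using c by (auto simp: pseudo_frobenius_def intro!: subsetD[OF c(2)])

text \<open>The left side lists the exponents of the socle of \<open>S\<close> modulo
  \<open>fps_X ^ e\<close>; subtracting \<open>e\<close> turns the socle condition into the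
  pseudo-Frobenius condition.\<close>

lemma socle_exponents:
  "{h \<in> H. \<forall>p\<in>H - {0}. h + p \<in> (+) e ` H} - (+) e ` H = (+) e ` pseudo_frobenius H"
proof (intro equalityI subsetI)
  fix h assume h: "h \<in> {h \<in> H. \<forall>p\<in>H - {0}. h + p \<in> (+) e ` H} - (+) e ` H"
  \<comment> \<open>Needed for \<open>e \<le> h\<close>. If \<open>h = 0\<close>, then testing with
    \<open>e + (c - 1)\<close>, which is at least \<open>c\<close>, would put \<open>c - 1\<close>
    into \<open>H\<close>.\<close>
  have "h \<noteq> 0"
  proof
    assume "h = 0"
    have "e + (c - 1) \<in> H - {0}"
      using c e(2) by (auto intro!: subsetD[OF c(2)])
    with h \<open>h = 0\<close> have "e + (c - 1) \<in> (+) e ` H" by fastforce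
    with c(3) show False by auto
  qed
  with h e(3) have le: "e \<le> h" by simp
  have "h - e \<in> pseudo_frobenius H"
    unfolding pseudo_frobenius_def
  proof (intro CollectI conjI ballI)
    have "h \<notin> (+) e ` H" using h by blast
    then show "h - e \<notin> H" using le by (metis image_eqI le_add_diff_inverse)
    fix p assume "p \<in> H - {0}"
    with h have "h + p \<in> (+) e ` H" by blast
    then obtain x where "x \<in> H" "h + p = e + x" by blast
    moreover from this le have "h - e + p = x" by simp
    ultimately show "h - e + p \<in> H" by simp
  qed
  with le show "h \<in> (+) e ` pseudo_frobenius H"
    by (intro image_eqI[of _ _ "h - e"]) auto
next
  fix h assume "h \<in> (+) e ` pseudo_frobenius H"
  then obtain p where p: "p \<in> pseudo_frobenius H" "h = e + p" by blast
  then have "p + e \<in> H" using e unfolding pseudo_frobenius_def by auto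
  with p show "h \<in> {h \<in> H. \<forall>p\<in>H - {0}. h + p \<in> (+) e ` H} - (+) e ` H"
    by (auto simp: pseudo_frobenius_def add.commute add.assoc)
qed

lemma reduced_socle_exponents:
  "({c..} \<union> (+) e ` H) - (+) e ` H = (+) e ` {p. p \<notin> H \<and> c \<le> p + e}"
proof (intro equalityI subsetI)
  fix n assume n: "n \<in> ({c..} \<union> (+) e ` H) - (+) e ` H"
  then have "c \<le> n" by auto
  \<comment> \<open>As \<open>n\<close> is at least \<open>c > 0\<close>, it is a nonzero element of
    \<open>H\<close>.\<close>
  moreover have "e \<le> n"
    using e(3)[of n] \<open>c \<le> n\<close> c by auto
  moreover have "n - e \<notin> H" using n \<open>e \<le> n\<close> by (metis DiffD2 image_eqI le_add_diff_inverse)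
  ultimately show "n \<in> (+) e ` {p. p \<notin> H \<and> c \<le> p + e}"
    by (intro image_eqI[of _ _ "n - e"]) auto
qed auto

text \<open>A nonzero \<open>h\<close> in \<open>H\<close> is at least \<open>e\<close>, so it
  carries such a gap to \<open>c\<close> or beyond. On cardinalities this is the inequality between
  reduced type and type.\<close>

lemma top_gaps_subset: "{p. p \<notin> H \<and> c \<le> p + e} \<subseteq> pseudo_frobenius H"
proof -
  have "p + h \<in> H" if "c \<le> p + e" "h \<in> H" "h \<noteq> 0" for p h
    using that e(3)[of h] by (intro subsetD[OF c(2)]) auto
  then show ?thesis by (auto simp: pseudo_frobenius_def)
qed

lemma cm_type_eq:
  "cm_type (semigroup_ring H :: 'a::field fps set) e = enat (card (pseudo_frobenius H))"
proof -
  let ?A = "{h \<in> H. \<forall>p\<in>H - {0}. h + p \<in> (+) e ` H}"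
  have "(+) e ` H \<subseteq> ?A"
    using add e(1) by (auto simp: add.assoc)
  moreover have "finite (?A - (+) e ` H)"
    unfolding socle_exponents using finite_pseudo_frobenius by simp
  ultimately have "cm_type (semigroup_ring H :: 'a fps set) e = enat (card (?A - (+) e ` H))"
    unfolding cm_type_def monomial_elt_set_times max_ideal_semigroup_ring[OF submonoid]
      colon_ideal_semigroup_ring
    by (rule quotient_dim_semigroup_ring)
  then show ?thesis by (simp add: socle_exponents card_image)
qed

lemma reduced_type_eq:
  "reduced_type (semigroup_ring H :: 'a::field fps set) e c = enat (card {p. p \<notin> H \<and> c \<le> p + e})"
proof -
  have "finite {p. p \<notin> H \<and> c \<le> p + e}"
    using top_gaps_subset finite_pseudo_frobenius by (rule finite_subset)
  then have "finite (({c..} \<union> (+) e ` H) - (+) e ` H)"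
    unfolding reduced_socle_exponents by simp
  then have "reduced_type (semigroup_ring H :: 'a fps set) e c
      = enat (card (({c..} \<union> (+) e ` H) - (+) e ` H))"
    unfolding reduced_type_def monomial_elt_set_times conductor_ideal_eq_semigroup_ring
      semigroup_ring_set_plus
    by (intro quotient_dim_semigroup_ring) auto
  then show ?thesis by (simp add: reduced_socle_exponents card_image)
qed

text \<open>The two lengths count the gaps and the elements of \<open>H\<close> below
  \<open>c\<close>; all terms are finite, so the identity in \<open>enat\<close> is one between
  naturals.\<close>

lemma almost_gorenstein_iff:
  "almost_gorenstein (semigroup_ring H :: 'a::field fps set) e c
     \<longleftrightarrow> card (- H) + 1 = card (H - {c..}) + card (pseudo_frobenius H)"
proof -
  have "quotient_length (semigroup_ring H) (semigroup_ring H) (semigroup_ring UNIV :: 'a fps set)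
      = enat (card (UNIV - H))"
    by (rule quotient_length_semigroup_ring[of _ _ _ c]) (use zero add c in auto)
  moreover have "quotient_length (semigroup_ring H) (semigroup_ring {c..})
      (semigroup_ring H :: 'a fps set) = enat (card (H - {c..}))"
    by (rule quotient_length_semigroup_ring[of _ _ _ c]) (use zero add c in auto)
  ultimately show ?thesis
    by (simp add: almost_gorenstein_def cm_type_eq conductor_ideal_eq_semigroup_ring
        Compl_eq_Diff_UNIV one_enat_def)
qed

section \<open>The symmetric pair and the two bounds\<close>

text \<open>Type different from one provides a pseudo-Frobenius number besides \<open>c - 1\<close>,
  and the symmetry provides its partner; \<open>p\<close> and \<open>q\<close> may coincide.\<close>

lemma almost_gorenstein_symmetric_pair:
  assumes "almost_gorenstein (semigroup_ring H :: 'a::field fps set) e c"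
    and "\<not> gorenstein (semigroup_ring H :: 'a fps set) e"
  obtains p q where "p \<in> pseudo_frobenius H" "q \<in> pseudo_frobenius H" "p + q = c - 1"
proof -
  have "card (pseudo_frobenius H) \<noteq> 1"
    using assms(2) by (simp add: gorenstein_def cm_type_eq one_enat_def)
  then have "pseudo_frobenius H \<noteq> {c - 1}" by auto
  then obtain p where p: "p \<in> pseudo_frobenius H" "p \<noteq> c - 1"
    using frobenius_in_pseudo_frobenius by blast
  have "p \<le> c - 1 \<and> c - 1 - p \<in> pseudo_frobenius H"
    using assms(1) c p
    by (intro pseudo_frobenius_symmetric submonoid) (simp_all add: almost_gorenstein_iff)
  then show ?thesis by (intro that[of p "c - 1 - p"] p(1)) auto
qed

lemma maximal_reduced_type_bound:
  assumes "maximal_reduced_type (semigroup_ring H :: 'a::field fps set) e c"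
    and "almost_gorenstein (semigroup_ring H :: 'a fps set) e c"
    and "\<not> gorenstein (semigroup_ring H :: 'a fps set) e"
  shows "c \<le> 2 * e - 1"
proof -
  \<comment> \<open>Equal finite cardinalities turn the inclusion \<open>top_gaps_subset\<close>
    into an equality of sets.\<close>
  have "{p. p \<notin> H \<and> c \<le> p + e} = pseudo_frobenius H"
    using assms(1) by (intro card_subset_eq finite_pseudo_frobenius top_gaps_subset)
      (simp add: maximal_reduced_type_def reduced_type_eq cm_type_eq)
  moreover obtain p q where "p \<in> pseudo_frobenius H" "q \<in> pseudo_frobenius H" "p + q = c - 1"
    using almost_gorenstein_symmetric_pair assms(2,3) by blast
  ultimately have "c \<le> p + e" "c \<le> q + e" "p + q = c - 1" by auto
  \<comment> \<open>Adding the two inequalities gives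
    \<open>2 * c \<le> c - 1 + 2 * e\<close>.\<close>
  then show ?thesis using e(2) c(1) by linarith
qed

lemma minimal_reduced_type_bound:
  assumes "minimal_reduced_type (semigroup_ring H :: 'a::field fps set) e c"
    and "almost_gorenstein (semigroup_ring H :: 'a fps set) e c"
    and "\<not> gorenstein (semigroup_ring H :: 'a fps set) e"
  shows "c \<ge> 2 * e + 3"
proof -
  have "card {p. p \<notin> H \<and> c \<le> p + e} = 1"
    using assms(1) by (simp add: minimal_reduced_type_def reduced_type_eq one_enat_def)
  moreover have "c - 1 \<in> {p. p \<notin> H \<and> c \<le> p + e}" using c e(2) by auto
  ultimately have top: "x = c - 1" if "x \<notin> H" "c \<le> x + e" for x
    using that by (metis (mono_tags, lifting) card_1_singletonE mem_Collect_eq singletonD)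
  obtain p q where pq: "p \<in> pseudo_frobenius H" "q \<in> pseudo_frobenius H" "p + q = c - 1"
    using almost_gorenstein_symmetric_pair assms(2,3) by blast
  then have gaps: "p \<notin> H" "q \<notin> H" by (auto simp: pseudo_frobenius_def)
  then have "p \<noteq> 0" "q \<noteq> 0" "p \<noteq> e" "q \<noteq> e" using zero e(1) by metis+
  \<comment> \<open>Neither \<open>p\<close> nor \<open>q\<close> is \<open>c - 1\<close>, since the
    other summand is nonzero; hence neither is the unique top gap.\<close>
  moreover from this have "p + e < c" "q + e < c"
    using top[OF gaps(1)] top[OF gaps(2)] pq(3) by linarith+
  \<comment> \<open>From \<open>p + e \<le> c - 1 = p + q\<close> follows \<open>e \<le> q\<close>,
    strictly since \<open>q \<noteq> e\<close>; likewise \<open>e < p\<close>. So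
    \<open>c - 1\<close> is at least \<open>2 * e + 2\<close>.\<close>
  ultimately show ?thesis using pq(3) by linarith
qed

end

theorem proposition3p16:
  fixes H :: "nat set" and b :: "nat \<Rightarrow> nat" and m c :: nat
    and S :: "'a::{alg_closed_field, field_char_0} fps set"
  assumes "numerical_semigroup H"
    and "strict_mono_on {1..m} b"
    and "minimally_generates (b ` {1..m}) H"
    and "c = conductor H"
    and "S = semigroup_ring H"
    and "almost_gorenstein S (b 1) c"
  shows "(maximal_reduced_type S (b 1) c \<and> \<not> gorenstein S (b 1) \<longrightarrow> c \<le> 2 * b 1 - 1) \<and>
         (minimal_reduced_type S (b 1) c \<and> \<not> gorenstein S (b 1) \<longrightarrow> c \<ge> 2 * b 1 + 3)"
proof -
  interpret numerical_semigroup_with_multiplicity H "b 1" c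
    using least_minimal_generator[OF assms(1-3)] conductor_properties[OF assms(1)] assms(1,4)
    by unfold_locales (auto simp: numerical_semigroup_def)
  show ?thesis
    using maximal_reduced_type_bound minimal_reduced_type_bound assms(5,6) by blast
qed

end
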